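(* Let $d\ge1$. Assume that $\kappa_d$ is an algebraic integer and a unit in the ring of integers $\mathcal{O}_K$ of $K=\mathbb{Q}(\kappa_d)$, and let $D=[K:\mathbb{Q}]$. Then: (1) $E_d=\emptyset$. (2) If $D=2$, then $d=1$.
   Context: For integers $d,n\ge1$, $T_d(n)$ is the Cayley graph of $(\mathbb{Z}/n\mathbb{Z})^d$ with respect to $\{\pm e_1,\dots,\pm e_d\}\setminus\{0\}$ ($e_i$ the standard basis vectors); it is a simple graph, and $T_d(1)$ is a single vertex with no edges. $a_d(n)$ is the number of independent sets of $T_d(n)$ (including the empty set), so $a_d(1)=2$. The limit $\kappa_d=\lim_{n\to\infty}a_d(n)^{1/n^d}$ exists and is a positive real number. $E_d=\{n\ge1: a_d(n)=\kappa_d^{n^d}\}$. *)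

theory Defs
  imports
    "HOL-Analysis.Analysis"
    "HOL-Algebra.Algebra"
    "HOL-Algebra.Algebraic_Closure_Type"
    "Graph_Theory.Pair_Digraph"
begin

section \<open>Independent sets of discrete tori\<close>

text \<open>Undirected graphs are represented by digraphs that contain both orientations of
  each edge. A Cayley graph is therefore undirected when \<open>S\<close> is closed under inverses,
  and has no loops when \<open>S\<close> does not contain the identity.\<close>

definition cayley_graph :: "('a, 'b) monoid_scheme \<Rightarrow> 'a set \<Rightarrow> 'a pair_pre_digraph" where
  "cayley_graph G S =
     \<lparr>pverts = carrier G,
      parcs = {(x, y). x \<in> carrier G \<and> y \<in> carrier G \<and> inv\<^bsub>G\<^esub> x \<otimes>\<^bsub>G\<^esub> y \<in> S}\<rparr>"

definition torus_group :: "nat \<Rightarrow> nat \<Rightarrow> (nat \<Rightarrow> int) monoid" where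
  "torus_group d n = product_group {..<d} (\<lambda>_. integer_mod_group n)"

text \<open>The reduction \<open>1 mod n\<close> is needed for \<open>n = 1\<close>, where \<open>e\<^sub>i = 0\<close>.\<close>

definition torus_unit_vector :: "nat \<Rightarrow> nat \<Rightarrow> nat \<Rightarrow> nat \<Rightarrow> int" where
  "torus_unit_vector d n i = (\<lambda>j\<in>{..<d}. if j = i then 1 mod int n else 0)"

definition torus_generators :: "nat \<Rightarrow> nat \<Rightarrow> (nat \<Rightarrow> int) set" where
  "torus_generators d n =
     (\<Union>i<d. {torus_unit_vector d n i, inv\<^bsub>torus_group d n\<^esub> torus_unit_vector d n i})
       - {\<one>\<^bsub>torus_group d n\<^esub>}"

definition torus_graph :: "nat \<Rightarrow> nat \<Rightarrow> (nat \<Rightarrow> int) pair_pre_digraph" where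
  "torus_graph d n = cayley_graph (torus_group d n) (torus_generators d n)"

definition independent_vertex_set :: "'a pair_pre_digraph \<Rightarrow> 'a set \<Rightarrow> bool" where
  "independent_vertex_set G A \<longleftrightarrow> A \<subseteq> pverts G \<and> (\<forall>u\<in>A. \<forall>v\<in>A. (u, v) \<notin> parcs G)"

definition num_indep :: "nat \<Rightarrow> nat \<Rightarrow> nat" where
  "num_indep d n = card {A. independent_vertex_set (torus_graph d n) A}"

definition kappa :: "nat \<Rightarrow> real" where
  "kappa d = lim (\<lambda>n. root (n ^ d) (real (num_indep d n)))"

definition exact_set :: "nat \<Rightarrow> nat set" where
  "exact_set d = {n. n \<ge> 1 \<and> real (num_indep d n) = kappa d ^ (n ^ d)}"

lemma group_torus_group: "group (torus_group d n)"
  by (simp add: torus_group_def)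

lemma torus_unit_vector_closed:
  assumes "n \<ge> 1" shows "torus_unit_vector d n i \<in> carrier (torus_group d n)"
  using assms by (auto simp: torus_group_def torus_unit_vector_def carrier_integer_mod_group)

lemma pair_graph_torus_graph:
  assumes "n \<ge> 1" shows "pair_graph (torus_graph d n)"
proof -
  interpret G: group "torus_group d n" by (rule group_torus_group)
  have fin: "finite (carrier (torus_group d n))"
    using assms by (auto simp: torus_group_def carrier_integer_mod_group intro!: finite_PiE)
  have inv_gen: "inv\<^bsub>torus_group d n\<^esub> s \<in> torus_generators d n" if "s \<in> torus_generators d n" for s
    using that torus_unit_vector_closed[OF assms, of d]
    unfolding torus_generators_def by (auto simp: G.inv_eq_1_iff)
  have sym: "inv\<^bsub>torus_group d n\<^esub> y \<otimes>\<^bsub>torus_group d n\<^esub> x \<in> torus_generators d n"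
    if "x \<in> carrier (torus_group d n)" "y \<in> carrier (torus_group d n)"
      "inv\<^bsub>torus_group d n\<^esub> x \<otimes>\<^bsub>torus_group d n\<^esub> y \<in> torus_generators d n" for x y
    using inv_gen[OF that(3)] that(1,2) by (simp add: G.inv_mult_group)
  show ?thesis
  proof
    show "finite (pverts (torus_graph d n))"
      using fin by (simp add: torus_graph_def cayley_graph_def)
    show "finite (parcs (torus_graph d n))"
      by (rule finite_subset[of _ "carrier (torus_group d n) \<times> carrier (torus_group d n)"])
         (auto simp: torus_graph_def cayley_graph_def fin)
    show "symmetric (with_proj (torus_graph d n))"
      by (auto simp: symmetric_def sym_def torus_graph_def cayley_graph_def arcs_ends_def
            arc_to_ends_def intro: sym)
  qed (auto simp: torus_graph_def cayley_graph_def torus_generators_def)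
qed

lemma num_indep_1: "num_indep d 1 = 2"
proof -
  interpret G: group "torus_group d 1" by (rule group_torus_group)
  have "torus_unit_vector d 1 i = \<one>\<^bsub>torus_group d 1\<^esub>" for i
    by (auto simp: torus_unit_vector_def torus_group_def product_group_def integer_mod_group_def)
  then have "torus_generators d 1 = {}"
    using group.is_monoid[OF group_torus_group, THEN monoid.inv_one]
    by (auto simp: torus_generators_def)
  moreover have "{0..<1::int} = {0}" by auto
  then have "carrier (torus_group d 1) = {\<lambda>i\<in>{..<d}. 0}"
    by (auto simp: torus_group_def integer_mod_group_def PiE_iff extensional_def fun_eq_iff)
  ultimately have "{A. independent_vertex_set (torus_graph d 1) A} = {{}, {\<lambda>i\<in>{..<d}. 0}}"
    by (auto simp: independent_vertex_set_def torus_graph_def cayley_graph_def)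
  then show ?thesis by (simp add: num_indep_def)
qed

section \<open>Number fields inside the reals\<close>

definition rat_adjoin :: "real \<Rightarrow> real set" where
  "rat_adjoin x = generate_field ring_of_type_algebra (insert x \<rat>)"

definition ring_of_integers :: "real set \<Rightarrow> real ring" where
  "ring_of_integers K = ring_of_type_algebra\<lparr>carrier := {x \<in> K. algebraic_int x}\<rparr>"

text \<open>Without finite dimension, \<open>ring.dim\<close> is unspecified; the degree is meant for
  finite extensions only.\<close>

definition degree_over_rat :: "real set \<Rightarrow> nat" where
  "degree_over_rat K = ring.dim ring_of_type_algebra \<rat> K"

end

theory Submission
  imports Defs "Jordan_Normal_Form.Char_Poly"
begin

text \<open>If \<open>\<kappa>\<close> is a unit and \<open>a(n) = \<kappa> ^ (n ^ d)\<close>, then \<open>1 / a(n)\<close> is a rational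
  algebraic integer, so \<open>a(n) = 1\<close>; but the empty set and a single vertex are two independent sets.

  A quadratic unit \<open>x > 1\<close> satisfies \<open>x\<^sup>2 + p x \<plusminus> 1 = 0\<close> with \<open>p\<close> an integer, hence is at
  least the golden ratio. For \<open>d \<ge> 2\<close> the limit is smaller: up to boundary effects, tori have as
  many independent sets as cubes in the grid, and cubes are submultiplicative under tilings, so
  \<open>\<kappa>\<close> is the infimum of the normalised counts in cubes. Tiling the cube of side 6 by
  \<open>2 \<times> 3\<close> rectangles, each with 17 independent sets, gives \<open>\<kappa> ^ 6 \<le> 17\<close>, while the sixth power
  of the golden ratio exceeds 17.9.\<close>

section \<open>Algebraic integers\<close>

text \<open>The characteristic polynomial of an integer matrix is monic with integer coefficients,
  so each of its eigenvalues in a larger field is an algebraic integer. The entry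
  \<open>i\<^sub>0\<close> keeps the vector from being zero.\<close>

lemma algebraic_int_of_int_eigenvector:
  fixes x :: "'a::field_char_0" and v :: "nat \<Rightarrow> 'a" and c :: "nat \<Rightarrow> nat \<Rightarrow> int"
  assumes eig: "\<And>i. i < n \<Longrightarrow> x * v i = (\<Sum>j<n. of_int (c i j) * v j)"
    and "i\<^sub>0 < n" "v i\<^sub>0 \<noteq> 0"
  shows "algebraic_int x"
proof -
  define M where "M = mat n n (\<lambda>(i, j). c i j)"
  have M: "M \<in> carrier_mat n n" by (simp add: M_def)
  let ?M = "map_mat of_int M :: 'a mat"
  have "eigenvector ?M (vec n v) x"
    unfolding eigenvector_def
  proof (intro conjI)
    show "vec n v \<noteq> 0\<^sub>v (dim_row ?M)"
      using assms(2,3) M by (metis carrier_matD(1) index_map_mat(2) index_vec index_zero_vec(1))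
    show "?M *\<^sub>v vec n v = x \<cdot>\<^sub>v vec n v"
      by (rule eq_vecI)
        (auto simp: M_def eig scalar_prod_def atLeast0LessThan intro!: sum.cong)
  qed (use M in auto)
  then have "poly (char_poly ?M) x = 0"
    using eigenvalue_root_char_poly[of ?M n x] M by (auto simp: eigenvalue_def)
  then have "poly (map_poly of_int (char_poly M)) x = 0"
    using of_int_hom.char_poly_hom[OF M, where 'a = 'a] by simp
  moreover have "Polynomial.lead_coeff (char_poly M) = 1"
    using degree_monic_char_poly[OF M] by auto
  ultimately show ?thesis
    by (auto simp: algebraic_int_altdef_ipoly)
qed

section \<open>Integer spans and the finite-module criterion for integrality\<close>

inductive_set int_span :: "'a::ring_1 set \<Rightarrow> 'a set" for S where
  int_span_zero: "0 \<in> int_span S"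
| int_span_step: "s \<in> S \<Longrightarrow> y \<in> int_span S \<Longrightarrow> of_int c * s + y \<in> int_span S"

lemma int_span_superset: "s \<in> S \<Longrightarrow> s \<in> int_span S"
  using int_span_step[of s S 0 1] int_span_zero[of S] by simp

lemma int_span_add:
  assumes "y \<in> int_span S" "z \<in> int_span S"
  shows "y + z \<in> int_span S"
  using assms by (induction) (auto simp: add.assoc intro: int_span_step)

lemma int_span_scale:
  assumes "y \<in> int_span S" shows "of_int c * y \<in> int_span S"
  using assms
proof induction
  case (int_span_step s y c')
  then show ?case
    using int_span.int_span_step[of s S "of_int c * y" "c * c'"] by (simp add: algebra_simps)
qed (auto intro: int_span_zero)

lemma int_span_sum: "(\<And>i. i \<in> I \<Longrightarrow> f i \<in> int_span S) \<Longrightarrow> sum f I \<in> int_span S"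
  by (induction I rule: infinite_finite_induct) (auto intro: int_span_zero int_span_add)

lemma int_span_finiteE:
  assumes "finite S" "y \<in> int_span S"
  obtains c where "y = (\<Sum>s\<in>S. of_int (c s) * s)"
proof -
  from assms(2) have "\<exists>c. y = (\<Sum>s\<in>S. of_int (c s) * s)"
  proof induction
    case int_span_zero
    show ?case by (rule exI[of _ "\<lambda>_. 0"]) simp
  next
    case (int_span_step s y a)
    then obtain c where c: "y = (\<Sum>s\<in>S. of_int (c s) * s)" by blast
    have "(\<Sum>t\<in>S. of_int ((c(s := c s + a)) t) * t)
        = (\<Sum>t\<in>S. (if t = s then of_int a * s else 0) + of_int (c t) * t)"
      by (rule sum.cong) (auto simp: algebra_simps)
    then show ?case
      using int_span_step(1) assms(1) c by (intro exI[of _ "c(s := c s + a)"]) (simp add: sum.distrib)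
  qed
  then show ?thesis using that by blast
qed

text \<open>Multiplication by \<open>x\<close> acts on the generators through an integer matrix, and
  the generators themselves, listed by \<open>h\<close>, are an eigenvector of it with eigenvalue
  \<open>x\<close>.\<close>

lemma algebraic_int_of_finite_module:
  fixes x :: "'a::field_char_0"
  assumes "finite S" "s\<^sub>0 \<in> S" "s\<^sub>0 \<noteq> 0" "\<And>s. s \<in> S \<Longrightarrow> x * s \<in> int_span S"
  shows "algebraic_int x"
proof -
  obtain h where h: "bij_betw h {..<card S} S"
    using ex_bij_betw_nat_finite[OF assms(1)] by (auto simp: atLeast0LessThan)
  have "\<exists>c. x * s = (\<Sum>t\<in>S. of_int (c t) * t)" if "s \<in> S" for s
    using int_span_finiteE[OF assms(1) assms(4)[OF that]] by metis
  then obtain c where c: "\<And>s. s \<in> S \<Longrightarrow> x * s = (\<Sum>t\<in>S. of_int (c s t) * t)" by metis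
  obtain i where i: "i < card S" "h i = s\<^sub>0"
    using h assms(2) by (metis bij_betw_iff_bijections lessThan_iff)
  show ?thesis
  proof (rule algebraic_int_of_int_eigenvector[of "card S" x h "\<lambda>i j. c (h i) (h j)"])
    fix i assume "i < card S"
    then have "h i \<in> S" using h by (auto simp: bij_betw_def)
    then show "x * h i = (\<Sum>j<card S. of_int (c (h i) (h j)) * h j)"
      using c sum.reindex_bij_betw[OF h, of "\<lambda>t. of_int (c (h i) t) * t"] by simp
  qed (use i assms in auto)
qed

lemma algebraic_intE:
  fixes x :: "'a::field_char_0"
  assumes "algebraic_int x"
  obtains m and c :: "nat \<Rightarrow> int" where "m > 0" "x ^ m = (\<Sum>i<m. of_int (c i) * x ^ i)"
proof -
  from assms obtain p :: "int poly" where p: "poly (map_poly of_int p) x = 0" "Polynomial.lead_coeff p = 1"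
    by (auto simp: algebraic_int_altdef_ipoly)
  have "Polynomial.degree p \<noteq> 0"
  proof
    assume "Polynomial.degree p = 0"
    then obtain a where "p = [:a:]" by (metis degree_eq_zeroE)
    with p show False by (auto simp: of_int_hom.map_poly_pCons_hom)
  qed
  moreover have "(\<Sum>i\<le>Polynomial.degree p. of_int (Polynomial.coeff p i) * x ^ i) = 0"
    using p(1) by (simp add: poly_altdef coeff_map_poly degree_map_poly)
  then have "x ^ Polynomial.degree p = (\<Sum>i<Polynomial.degree p. of_int (- Polynomial.coeff p i) * x ^ i)"
    using p(2) by (simp add: lessThan_Suc_atMost[symmetric] sum_negf add_eq_0_iff)
  ultimately show ?thesis using that[of "Polynomial.degree p" "\<lambda>i. - Polynomial.coeff p i"] by simp
qed

text \<open>The finitely many monomials in \<open>S\<close> already span every monomial in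
  \<open>x\<close> and \<open>y\<close> over the integers, and the span of all monomials is stable
  under multiplication by \<open>x + y\<close> and by \<open>x * y\<close>.\<close>

lemma algebraic_int_plus_times:
  fixes x y :: "'a::field_char_0"
  assumes "algebraic_int x" "algebraic_int y"
  shows "algebraic_int (x + y)" and "algebraic_int (x * y)"
proof -
  obtain m c where m: "m > 0" and c: "x ^ m = (\<Sum>i<m. of_int (c i :: int) * x ^ i)"
    using algebraic_intE[OF assms(1)] .
  obtain n e where n: "n > 0" and e: "y ^ n = (\<Sum>j<n. of_int (e j :: int) * y ^ j)"
    using algebraic_intE[OF assms(2)] .
  define S where "S = (\<lambda>(i, j). x ^ i * y ^ j) ` ({..<m} \<times> {..<n})"
  have "finite S" by (simp add: S_def)
  have "1 \<in> S" using m n by (force simp: S_def image_iff)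
  \<comment> \<open>Induction on the total degree: an exponent that is too large is lowered by the
    monic relation of \<open>x\<close> or of \<open>y\<close>.\<close>
  have all: "x ^ k * y ^ l \<in> int_span S" for k l
  proof (induction "k + l" arbitrary: k l rule: less_induct)
    case less
    consider "k < m" "l < n" | "k \<ge> m" | "l \<ge> n" by linarith
    then show ?case
    proof cases
      case 1
      then show ?thesis by (auto simp: S_def intro!: int_span_superset)
    next
      case 2
      then obtain r where r: "k = m + r" using le_Suc_ex by blast
      have "x ^ k * y ^ l = (\<Sum>i<m. of_int (c i) * (x ^ (i + r) * y ^ l))"
        by (simp add: r power_add c sum_distrib_right sum_distrib_left mult_ac)
      also have "\<dots> \<in> int_span S"
        by (rule int_span_sum, rule int_span_scale) (use less r in auto)
      finally show ?thesis .
    next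
      case 3
      then obtain r where r: "l = n + r" using le_Suc_ex by blast
      have "x ^ k * y ^ l = (\<Sum>j<n. of_int (e j) * (x ^ k * y ^ (j + r)))"
        by (simp add: r power_add e sum_distrib_right sum_distrib_left mult_ac)
      also have "\<dots> \<in> int_span S"
        by (rule int_span_sum, rule int_span_scale) (use less r in auto)
      finally show ?thesis .
    qed
  qed
  show "algebraic_int (x + y)"
  proof (rule algebraic_int_of_finite_module[OF \<open>finite S\<close> \<open>1 \<in> S\<close>])
    fix s assume "s \<in> S"
    then obtain i j where "s = x ^ i * y ^ j" by (auto simp: S_def)
    then have "(x + y) * s = x ^ Suc i * y ^ j + x ^ i * y ^ Suc j" by (simp add: algebra_simps)
    then show "(x + y) * s \<in> int_span S" by (simp only: int_span_add all)
  qed simp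
  show "algebraic_int (x * y)"
  proof (rule algebraic_int_of_finite_module[OF \<open>finite S\<close> \<open>1 \<in> S\<close>])
    fix s assume "s \<in> S"
    then obtain i j where "s = x ^ i * y ^ j" by (auto simp: S_def)
    then have "(x * y) * s = x ^ Suc i * y ^ Suc j" by (simp add: algebra_simps)
    then show "(x * y) * s \<in> int_span S" by (simp only: all)
  qed simp
qed

lemma algebraic_int_power:
  fixes x :: "'a::field_char_0"
  shows "algebraic_int x \<Longrightarrow> algebraic_int (x ^ n)"
  by (induction n) (auto intro: algebraic_int_plus_times)

text \<open>The second root \<open>- p - x\<close> is again an algebraic integer: modulo the quadratic, an integer
  polynomial vanishing at \<open>x\<close> has a linear remainder with rational coefficients, which is zero
  because \<open>x\<close> is irrational.\<close>

lemma quadratic_algebraic_int_coeffs: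
  fixes x p q :: "'a::field_char_0"
  assumes "algebraic_int x" "x \<notin> \<rat>" "p \<in> \<rat>" "q \<in> \<rat>" and quad: "x ^ 2 + p * x + q = 0"
  shows "p \<in> \<int>" and "q \<in> \<int>"
proof -
  from assms(1) obtain f :: "int poly" where f: "poly (map_poly of_int f) x = 0" "Polynomial.lead_coeff f = 1"
    by (auto simp: algebraic_int_altdef_ipoly)
  \<comment> \<open>Quantifying over all roots \<open>z\<close> of the quadratic lets the same
    \<open>r\<close> and \<open>s\<close> serve both \<open>x\<close> and the second root.\<close>
  have rem: "\<exists>r\<in>\<rat>. \<exists>s\<in>\<rat>. \<forall>z. z ^ 2 + p * z + q = 0 \<longrightarrow> poly (map_poly of_int g) z = r * z + s"
    for g :: "int poly"
  proof (induction g)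
    case 0
    show ?case by (intro bexI[of _ 0] bexI[of _ 0]) auto
  next
    case (pCons a g)
    then obtain r s where rs: "r \<in> \<rat>" "s \<in> \<rat>"
      "\<And>z. z ^ 2 + p * z + q = 0 \<Longrightarrow> poly (map_poly of_int g) z = r * z + s" by blast
    show ?case
    proof (intro bexI allI impI)
      fix z assume z: "z ^ 2 + p * z + q = 0"
      then have "z * z - (- p * z - q) = 0" by (simp add: power2_eq_square algebra_simps)
      then have zz: "z * z = - p * z - q" by simp
      have "poly (map_poly of_int (pCons a g)) z = of_int a + r * (z * z) + s * z"
        using rs(3)[OF z] by (simp add: of_int_hom.map_poly_pCons_hom algebra_simps)
      then show "poly (map_poly of_int (pCons a g)) z = (s - r * p) * z + (of_int a - r * q)"
        by (simp add: zz algebra_simps)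
    qed (use rs assms in auto)
  qed
  from rem[of f] obtain r s where rs: "r \<in> \<rat>" "s \<in> \<rat>"
    "\<And>z. z ^ 2 + p * z + q = 0 \<Longrightarrow> poly (map_poly of_int f) z = r * z + s" by blast
  have lin: "r * x + s = 0" using rs(3)[OF quad] f by simp
  have "r = 0"
  proof (rule ccontr)
    assume "r \<noteq> 0"
    then have "x = - s / r" using lin by (simp add: field_simps add_eq_0_iff)
    then show False using rs assms(2) by auto
  qed
  with lin have "s = 0" by simp
  define y where "y = - p - x"
  have "x * y - q = - (x ^ 2 + p * x + q)"
    by (simp add: y_def power2_eq_square algebra_simps)
  then have prod: "x * y = q" using quad by simp
  have "y ^ 2 + p * y + q = 0"
    unfolding prod[symmetric] by (simp add: y_def power2_eq_square algebra_simps)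
  then have "algebraic_int y"
    using rs(3) f \<open>r = 0\<close> \<open>s = 0\<close> by (auto simp: algebraic_int_altdef_ipoly)
  then have "algebraic_int (x + y)" "algebraic_int (x * y)"
    using assms(1) algebraic_int_plus_times by blast+
  then have "algebraic_int (- p)" "algebraic_int q"
    by (simp add: y_def, simp add: prod)
  then show "p \<in> \<int>" "q \<in> \<int>"
    using assms(3,4) rational_algebraic_int_is_int by auto
qed

text \<open>The inverse \<open>y\<close> is a root of the reversed quadratic, whose constant term is
  \<open>1 / q\<close>. Integrality of \<open>x\<close> and of \<open>y\<close> thus makes both
  \<open>q\<close> and \<open>1 / q\<close> integers.\<close>

lemma quadratic_unit_coeffs:
  fixes x y p q :: "'a::field_char_0"
  assumes "algebraic_int x" "algebraic_int y" "x * y = 1" "x \<notin> \<rat>" "p \<in> \<rat>" "q \<in> \<rat>"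
    and quad: "x ^ 2 + p * x + q = 0"
  shows "p \<in> \<int>" and "q = 1 \<or> q = - 1"
proof -
  show "p \<in> \<int>" using quadratic_algebraic_int_coeffs[of x p q] assms by blast
  have "q \<in> \<int>" using quadratic_algebraic_int_coeffs[of x p q] assms by blast
  have "x \<noteq> 0" using assms(4) by auto
  then have y: "y = inverse x" using assms(3) by (simp add: inverse_unique)
  \<comment> \<open>Otherwise the nonzero root \<open>x\<close> would be the rational number
    \<open>- p\<close>.\<close>
  have "q \<noteq> 0"
  proof
    assume "q = 0"
    then have "x * (x + p) = 0" using quad by (simp add: power2_eq_square algebra_simps)
    then have "x = - p" using \<open>x \<noteq> 0\<close> by (simp add: add_eq_0_iff2)
    then show False using assms by auto
  qed
  have "y \<notin> \<rat>" using assms(4) y by (metis Rats_inverse inverse_inverse_eq)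
  moreover have "y ^ 2 + p / q * y + 1 / q = 0"
  proof -
    have "y ^ 2 + p / q * y + 1 / q = (x ^ 2 + p * x + q) / (q * x ^ 2)"
      using \<open>x \<noteq> 0\<close> \<open>q \<noteq> 0\<close> by (simp add: y field_simps power2_eq_square)
    then show ?thesis using quad by simp
  qed
  ultimately have "1 / q \<in> \<int>"
    using quadratic_algebraic_int_coeffs(2)[of y "p / q" "1 / q"] assms by auto
  then obtain b where b: "1 / q = of_int b" by (auto elim: Ints_cases)
  obtain a where a: "q = of_int a" using \<open>q \<in> \<int>\<close> by (auto elim: Ints_cases)
  have "of_int (a * b) = (1 :: 'a)" using a b \<open>q \<noteq> 0\<close> by (simp flip: b)
  then have "a * b = 1" by (simp only: of_int_eq_1_iff)
  then show "q = 1 \<or> q = - 1" using a by (auto simp: zmult_eq_1_iff)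
qed

section \<open>Degree over the rationals\<close>

abbreviation real_ring :: "real ring" where
  "real_ring \<equiv> ring_of_type_algebra"

lemma real_ring_simps:
  "carrier real_ring = UNIV" "x \<otimes>\<^bsub>real_ring\<^esub> y = x * y" "x \<oplus>\<^bsub>real_ring\<^esub> y = x + y"
  "\<one>\<^bsub>real_ring\<^esub> = 1" "\<zero>\<^bsub>real_ring\<^esub> = 0"
  by (simp_all add: ring_of_type_algebra_def)

lemma a_inv_real_ring: "\<ominus>\<^bsub>real_ring\<^esub> x = - x"
proof -
  interpret field real_ring by (rule field_from_type_algebra)
  show ?thesis
    using minus_equality[of "- x" x] by (simp add: real_ring_simps)
qed

lemma m_inv_real_ring: "x \<noteq> 0 \<Longrightarrow> inv\<^bsub>real_ring\<^esub> x = inverse x"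
proof -
  assume "x \<noteq> 0"
  interpret field real_ring by (rule field_from_type_algebra)
  show ?thesis
    using comm_inv_char[of x "inverse x"] \<open>x \<noteq> 0\<close> by (simp add: real_ring_simps)
qed

lemma subfield_Rats: "subfield \<rat> real_ring"
proof -
  interpret field real_ring by (rule field_from_type_algebra)
  show ?thesis
  proof (rule subfieldI')
    show "subring \<rat> real_ring"
      by (rule subringI) (auto simp: real_ring_simps a_inv_real_ring)
  qed (auto simp: real_ring_simps m_inv_real_ring)
qed

text \<open>Polynomials of the algebraic library are lists with the leading coefficient first,
  whereas \<open>Poly\<close> expects the constant term first; hence \<open>rev\<close>.\<close>

lemma eval_real_ring:
  "ring.eval real_ring xs x = poly (Poly (rev xs)) x"
proof -
  interpret field real_ring by (rule field_from_type_algebra)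
  have nat_pow: "x [^]\<^bsub>real_ring\<^esub> n = x ^ n" for n :: nat
    by (induction n) (auto simp: real_ring_simps mult.commute nat_pow_def)
  show ?thesis
    by (induction xs)
      (auto simp: real_ring_simps nat_pow Poly_snoc poly_monom algebra_simps)
qed

lemma algebraic_over_Rats:
  assumes "algebraic_int x"
  shows "(ring.algebraic real_ring over \<rat>) x"
proof -
  interpret field real_ring by (rule field_from_type_algebra)
  from assms obtain p where p: "Polynomial.lead_coeff p = 1" "\<forall>i. Polynomial.coeff p i \<in> \<int>" "poly p x = 0"
    by (auto elim: algebraic_int.cases)
  then have "p \<noteq> 0" by auto
  show ?thesis
  proof (rule algebraicI)
    show "rev (coeffs p) \<in> carrier (\<rat>[X]\<^bsub>real_ring\<^esub>)"
      unfolding univ_poly_carrier[symmetric] polynomial_def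
      using p \<open>p \<noteq> 0\<close> Ints_subset_Rats
      by (auto simp: real_ring_simps hd_rev last_coeffs_eq_coeff_degree coeffs_def)
    show "rev (coeffs p) \<noteq> []" using \<open>p \<noteq> 0\<close> by simp
    show "eval (rev (coeffs p)) x = \<zero>\<^bsub>real_ring\<^esub>"
      using p by (simp add: eval_real_ring real_ring_simps)
  qed
qed

text \<open>The simple extension consists of the values at \<open>x\<close> of rational polynomials.
  It is a field because \<open>x\<close> is algebraic, and then it is the least field containing
  \<open>x\<close> and the rationals.\<close>

lemma rat_adjoin_eq_simple_extension:
  assumes "algebraic_int x"
  shows "rat_adjoin x = ring.simple_extension real_ring \<rat> x"
proof -
  interpret field real_ring by (rule field_from_type_algebra)
  have sub: "subring \<rat> real_ring" using subfield_Rats by (rule subfieldE(1))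
  have "subfield (simple_extension \<rat> x) real_ring"
    using simple_extension_is_subfield[OF subfield_Rats] algebraic_over_Rats[OF assms]
    by (simp add: real_ring_simps)
  moreover have "insert x \<rat> \<subseteq> simple_extension \<rat> x"
    using simple_extension_mem[OF sub] simple_extension_incl[of \<rat> x]
    by (simp add: real_ring_simps)
  moreover have "simple_extension \<rat> x \<subseteq> F" if "subfield F real_ring" "insert x \<rat> \<subseteq> F" for F
    using simple_extension_subring_incl[OF subfieldE(1)[OF that(1)]] that(2) by auto
  ultimately show ?thesis
    unfolding rat_adjoin_def by (intro generate_fieldI[symmetric]) (auto simp: real_ring_simps)
qed

lemma degree_over_rat_adjoin:
  assumes "algebraic_int x"
  shows "degree_over_rat (rat_adjoin x) = Polynomials.degree (ring.Irr real_ring \<rat> x)"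
proof -
  interpret field real_ring by (rule field_from_type_algebra)
  show ?thesis
    using simple_extension_dim[OF subfield_Rats _ algebraic_over_Rats[OF assms]]
    by (simp add: degree_over_rat_def over_def rat_adjoin_eq_simple_extension[OF assms] real_ring_simps)
qed

text \<open>The quadratic is the minimal polynomial of \<open>x\<close>, a monic list of three
  coefficients. A rational \<open>x\<close> would give an extension of dimension one.\<close>

lemma degree_over_rat_2E:
  assumes "algebraic_int x" "degree_over_rat (rat_adjoin x) = 2"
  obtains p q where "x \<notin> \<rat>" "p \<in> \<rat>" "q \<in> \<rat>" "x ^ 2 + p * x + q = 0"
proof -
  interpret field real_ring by (rule field_from_type_algebra)
  note alg = algebraic_over_Rats[OF assms(1)]
  have x: "x \<in> carrier real_ring" by (simp add: real_ring_simps)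
  note Irr = IrrE[OF subfield_Rats x alg]
  have "length (Irr \<rat> x) = 3"
    using assms(2) degree_over_rat_adjoin[OF assms(1)] by simp
  then obtain a p q where I: "Irr \<rat> x = [a, p, q]"
    by (auto simp: numeral_3_eq_3 length_Suc_conv)
  have "p \<in> \<rat>" "q \<in> \<rat>" "a = 1"
    using Irr(1,3) I unfolding univ_poly_carrier[symmetric] polynomial_def
    by (auto simp: real_ring_simps)
  moreover have "x ^ 2 + p * x + q = 0"
    using Irr(4) \<open>a = 1\<close> by (simp add: I eval_real_ring real_ring_simps power2_eq_square algebra_simps)
  moreover have "x \<notin> \<rat>"
  proof
    assume "x \<in> \<rat>"
    then have "simple_extension \<rat> x \<subseteq> \<rat>"
      using simple_extension_subring_incl[OF subfieldE(1)[OF subfield_Rats], of \<rat> x] by simp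
    moreover have "\<rat> \<subseteq> simple_extension \<rat> x"
      using simple_extension_incl[of \<rat> x] by (simp add: real_ring_simps)
    ultimately have "simple_extension \<rat> x = \<rat>" by blast
    then have "degree_over_rat (rat_adjoin x) = 1"
      using dimI[OF subfield_Rats dimension_one[OF subfield_Rats]]
      by (simp add: degree_over_rat_def over_def rat_adjoin_eq_simple_extension[OF assms(1)])
    then show False using assms(2) by simp
  qed
  ultimately show ?thesis using that by blast
qed

section \<open>Counting independent sets in boxes of the grid\<close>

text \<open>Relation and vertex set are separate arguments, so that finite parts of the infinite
  grid can be compared with the torus on the same vertices.\<close>

definition indep_sets :: "('a \<times> 'a) set \<Rightarrow> 'a set \<Rightarrow> 'a set set" where
  "indep_sets E S = {A. A \<subseteq> S \<and> (\<forall>u\<in>A. \<forall>v\<in>A. (u, v) \<notin> E)}"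

lemma finite_indep_sets: "finite S \<Longrightarrow> finite (indep_sets E S)"
  by (rule finite_subset[of _ "Pow S"]) (auto simp: indep_sets_def)

lemma card_indep_sets_pos: "finite S \<Longrightarrow> card (indep_sets E S) > 0"
  using finite_indep_sets[of S E] by (auto simp: card_gt_0_iff indep_sets_def)

lemma card_indep_sets_empty [simp]: "card (indep_sets E {}) = 1"
proof -
  have "indep_sets E {} = {{}}" by (auto simp: indep_sets_def)
  then show ?thesis by simp
qed

lemma card_indep_sets_mono:
  assumes "finite T" "S \<subseteq> T"
  shows "card (indep_sets E S) \<le> card (indep_sets E T)"
  by (rule card_mono[OF finite_indep_sets[OF assms(1)]]) (use assms(2) in \<open>auto simp: indep_sets_def\<close>)

text \<open>An independent set is determined by its traces on the two parts, and both traces are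
  independent.\<close>

lemma card_indep_sets_Un:
  assumes "finite S" "finite T"
  shows "card (indep_sets E (S \<union> T)) \<le> card (indep_sets E S) * card (indep_sets E T)"
proof -
  have "card (indep_sets E (S \<union> T)) \<le> card (indep_sets E S \<times> indep_sets E T)"
  proof (rule card_inj_on_le[of "\<lambda>A. (A \<inter> S, A \<inter> T)"])
    show "inj_on (\<lambda>A. (A \<inter> S, A \<inter> T)) (indep_sets E (S \<union> T))"
      by (rule inj_onI) (auto simp: indep_sets_def)
  qed (use assms in \<open>auto simp: indep_sets_def finite_indep_sets intro: finite_subset\<close>)
  then show ?thesis by (simp add: card_cartesian_product)
qed

lemma card_indep_sets_UN:
  assumes "finite I" "\<And>i. i \<in> I \<Longrightarrow> finite (S i)"
  shows "card (indep_sets E (\<Union>i\<in>I. S i)) \<le> (\<Prod>i\<in>I. card (indep_sets E (S i)))"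
  using assms
proof (induction I rule: finite_induct)
  case (insert i I)
  have "card (indep_sets E (\<Union>j\<in>insert i I. S j))
      \<le> card (indep_sets E (S i)) * card (indep_sets E (\<Union>j\<in>I. S j))"
    using card_indep_sets_Un[of "S i" "\<Union>j\<in>I. S j" E] insert by simp
  also have "\<dots> \<le> card (indep_sets E (S i)) * (\<Prod>j\<in>I. card (indep_sets E (S j)))"
    using insert by (intro mult_left_mono) auto
  finally show ?case using insert by simp
qed simp

text \<open>The preimage of an independent set under an edge-preserving map is independent, and a
  subset of the image is recovered from its preimage. Extra edges in \<open>E'\<close> can only
  lower the count.\<close>

lemma card_indep_sets_image:
  assumes "finite S" "inj_on f S"
    and "\<And>u v. u \<in> S \<Longrightarrow> v \<in> S \<Longrightarrow> (u, v) \<in> E \<Longrightarrow> (f u, f v) \<in> E'"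
  shows "card (indep_sets E' (f ` S)) \<le> card (indep_sets E S)"
proof -
  have "indep_sets E' (f ` S) \<subseteq> (`) f ` indep_sets E S"
  proof
    fix B assume B: "B \<in> indep_sets E' (f ` S)"
    then have "B = f ` {u \<in> S. f u \<in> B}" by (auto simp: indep_sets_def)
    moreover have "{u \<in> S. f u \<in> B} \<in> indep_sets E S"
      using B assms(3) unfolding indep_sets_def by blast
    ultimately show "B \<in> (`) f ` indep_sets E S" by blast
  qed
  then show ?thesis
    using finite_indep_sets[OF assms(1)] by (rule surj_card_le[rotated])
qed

text \<open>The vertex recursion: an independent set either avoids \<open>v\<close>, or contains it
  and then avoids the neighbours of \<open>v\<close>.\<close>

lemma card_indep_sets_insert:
  assumes "finite S"
  shows "card (indep_sets E (insert v S))
    \<le> card (indep_sets E S) + card (indep_sets E {u \<in> S. u \<noteq> v \<and> (v, u) \<notin> E})"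
    (is "_ \<le> _ + card (indep_sets E ?T)")
proof -
  have "indep_sets E (insert v S) \<subseteq> indep_sets E S \<union> insert v ` indep_sets E ?T"
  proof
    fix A assume A: "A \<in> indep_sets E (insert v S)"
    show "A \<in> indep_sets E S \<union> insert v ` indep_sets E ?T"
    proof (cases "v \<in> A")
      case True
      then have "A = insert v (A - {v})" "A - {v} \<in> indep_sets E ?T"
        using A by (auto simp: indep_sets_def)
      then show ?thesis by blast
    qed (use A in \<open>auto simp: indep_sets_def\<close>)
  qed
  then have "card (indep_sets E (insert v S)) \<le> card (indep_sets E S \<union> insert v ` indep_sets E ?T)"
    using assms by (intro card_mono) (auto simp: finite_indep_sets)
  also have "\<dots> \<le> card (indep_sets E S) + card (insert v ` indep_sets E ?T)"
    by (rule card_Un_le)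
  also have "\<dots> \<le> card (indep_sets E S) + card (indep_sets E ?T)"
    using assms by (intro add_left_mono card_image_le finite_indep_sets) auto
  finally show ?thesis .
qed

section \<open>Boxes in the integer grid and their tilings\<close>

definition grid_edges :: "nat \<Rightarrow> ((nat \<Rightarrow> int) \<times> (nat \<Rightarrow> int)) set" where
  "grid_edges d = {(x, y). \<exists>i<d. y = x(i := x i + 1) \<or> x = y(i := y i + 1)}"

text \<open>Side lengths may differ between directions, as the \<open>2 \<times> 3\<close> tile
  requires. Extensional functions make the cube of side \<open>n\<close> literally the vertex set of
  the torus.\<close>

definition grid_box :: "nat \<Rightarrow> (nat \<Rightarrow> nat) \<Rightarrow> (nat \<Rightarrow> int) set" where
  "grid_box d s = (\<Pi>\<^sub>E i\<in>{..<d}. {0..<int (s i)})"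

definition box_count :: "nat \<Rightarrow> (nat \<Rightarrow> nat) \<Rightarrow> nat" where
  "box_count d s = card (indep_sets (grid_edges d) (grid_box d s))"

lemma finite_grid_box [simp]: "finite (grid_box d s)"
  by (simp add: grid_box_def finite_PiE)

lemma box_count_pos: "box_count d s > 0"
  by (simp add: box_count_def card_indep_sets_pos)

lemma box_count_mono: "(\<And>i. i < d \<Longrightarrow> s i \<le> t i) \<Longrightarrow> box_count d s \<le> box_count d t"
  unfolding box_count_def grid_box_def
  by (intro card_indep_sets_mono finite_PiE PiE_mono) auto

lemma zdiv_less_mult:
  fixes x m s :: int
  assumes "x < m * s" "0 < s"
  shows "x div s < m"
proof (rule ccontr)
  assume "\<not> x div s < m"
  then have "m * s \<le> x div s * s" using assms(2) by (intro mult_right_mono) auto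
  then show False
    using div_mult_mod_eq[of x s] pos_mod_sign[OF assms(2), of x] assms(1) by linarith
qed

text \<open>The large box is covered by disjoint translates of the box with side lengths \<open>s\<close>, indexed
  by the points of the box with side lengths \<open>m\<close>.\<close>

lemma box_count_tiling:
  assumes "\<And>i. i < d \<Longrightarrow> s i > 0"
  shows "box_count d (\<lambda>i. m i * s i) \<le> box_count d s ^ (\<Prod>i<d. m i)"
proof -
  define tr where "tr t x = (\<lambda>i\<in>{..<d}. t i * int (s i) + x i)" for t x :: "nat \<Rightarrow> int"
  have cover: "grid_box d (\<lambda>i. m i * s i) \<subseteq> (\<Union>t\<in>grid_box d m. tr t ` grid_box d s)"
  proof
    fix x assume x: "x \<in> grid_box d (\<lambda>i. m i * s i)"
    \<comment> \<open>Division with remainder by the side lengths: the quotient selects the tile and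
      the remainder gives the position inside it.\<close>
    define t where "t = (\<lambda>i\<in>{..<d}. x i div int (s i))"
    define y where "y = (\<lambda>i\<in>{..<d}. x i mod int (s i))"
    have xi: "0 \<le> x i" "x i < int (m i) * int (s i)" if "i < d" for i
      using x that by (auto simp: grid_box_def PiE_iff)
    have "t \<in> grid_box d m"
      using assms xi by (auto simp: grid_box_def t_def pos_imp_zdiv_nonneg_iff zdiv_less_mult)
    moreover have "y \<in> grid_box d s" using assms by (auto simp: grid_box_def y_def)
    moreover have "x = tr t y"
      using x by (auto simp: tr_def t_def y_def grid_box_def PiE_iff extensional_def fun_eq_iff)
    ultimately show "x \<in> (\<Union>t\<in>grid_box d m. tr t ` grid_box d s)" by blast
  qed
  have tile: "card (indep_sets (grid_edges d) (tr t ` grid_box d s)) \<le> box_count d s" for t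
    unfolding box_count_def
  proof (rule card_indep_sets_image)
    show "inj_on (tr t) (grid_box d s)"
    proof (rule inj_onI)
      fix x y assume "x \<in> grid_box d s" "y \<in> grid_box d s" "tr t x = tr t y"
      then show "x = y"
        by (intro PiE_ext[of x "{..<d}" _ y]) (auto simp: grid_box_def tr_def fun_eq_iff split: if_splits)
    qed
    have shift: "tr t (x(i := x i + 1)) = (tr t x)(i := tr t x i + 1)" if "i < d" for x i
      using that by (auto simp: tr_def fun_eq_iff)
    show "(tr t x, tr t y) \<in> grid_edges d" if "(x, y) \<in> grid_edges d" for x y
    proof -
      from that obtain i where "i < d" "y = x(i := x i + 1) \<or> x = y(i := y i + 1)"
        by (auto simp: grid_edges_def)
      then have "tr t y = (tr t x)(i := tr t x i + 1) \<or> tr t x = (tr t y)(i := tr t y i + 1)"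
        using shift by metis
      with \<open>i < d\<close> show ?thesis by (auto simp: grid_edges_def)
    qed
  qed simp
  have "box_count d (\<lambda>i. m i * s i)
      \<le> card (indep_sets (grid_edges d) (\<Union>t\<in>grid_box d m. tr t ` grid_box d s))"
    unfolding box_count_def by (rule card_indep_sets_mono[OF _ cover]) simp
  also have "\<dots> \<le> (\<Prod>t\<in>grid_box d m. card (indep_sets (grid_edges d) (tr t ` grid_box d s)))"
    by (rule card_indep_sets_UN) auto
  also have "\<dots> \<le> (\<Prod>t\<in>grid_box d m. box_count d s)"
    by (rule prod_mono) (simp add: tile)
  also have "\<dots> = box_count d s ^ (\<Prod>i<d. m i)"
    by (simp add: grid_box_def card_PiE)
  finally show ?thesis .
qed

text \<open>Without the middle vertex \<open>(0,1)\<close> the rectangle is a path on five vertices,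
  whose counts grow as the Fibonacci numbers 2, 3, 5, 8, 13. With \<open>(0,1)\<close> chosen, only
  the non-adjacent vertices \<open>(1,0)\<close> and \<open>(1,2)\<close> remain free, which adds
  4.\<close>

lemma card_indep_sets_ladder:
  fixes E :: "((int \<times> int) \<times> (int \<times> int)) set"
  defines "E \<equiv> {((a, b), (a', b')). \<bar>a - a'\<bar> + \<bar>b - b'\<bar> = 1}"
  shows "card (indep_sets E ({0..<2} \<times> {0..<3})) \<le> 17"
proof -
  have [simp]: "((a, b), (a', b')) \<in> E \<longleftrightarrow> \<bar>a - a'\<bar> + \<bar>b - b'\<bar> = 1" for a b a' b'
    by (simp add: E_def)
  \<comment> \<open>Lists fix the order of deletion, and the neighbour filters in
    \<open>Cons\<close> become computable by simplification.\<close>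
  define N where "N xs = card (indep_sets E (set xs))" for xs
  have Nil: "N [] = 1" by (simp add: N_def)
  have Cons: "N (v # xs) \<le> N xs + N (filter (\<lambda>u. u \<noteq> v \<and> (v, u) \<notin> E) xs)" for v xs
    using card_indep_sets_insert[of "set xs" E v] by (simp add: N_def)
  have "{0..<2} = {0, 1 :: int}" "{0..<3} = {0, 1, 2 :: int}" by auto
  then have V: "{0..<2 :: int} \<times> {0..<3} = set [(0,1), (0,0), (1,0), (1,1), (1,2), (0, 2 :: int)]"
    by auto
  have a: "N [u] \<le> 2" for u
    using Cons[of u "[]"] by (simp add: Nil)
  have b: "N [(1,2), (0,2)] \<le> 3"
    using Cons[of "(1,2)" "[(0,2)]"] a[of "(0,2)"] by (simp add: Nil)
  have c: "N [(1,1), (1,2), (0,2)] \<le> 5"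
    using Cons[of "(1,1)" "[(1,2), (0,2)]"] a[of "(0,2)"] b by simp
  have d: "N [(1,0), (1,1), (1,2), (0,2)] \<le> 8"
    using Cons[of "(1,0)" "[(1,1), (1,2), (0,2)]"] b c by simp
  have e: "N [(0,0), (1,0), (1,1), (1,2), (0,2)] \<le> 13"
    using Cons[of "(0,0)" "[(1,0), (1,1), (1,2), (0,2)]"] c d by simp
  have "N [(1,0), (1,2)] \<le> 4"
    using Cons[of "(1,0)" "[(1,2)]"] a[of "(1,2)"] by simp
  then have "N [(0,1), (0,0), (1,0), (1,1), (1,2), (0,2)] \<le> 17"
    using Cons[of "(0,1)" "[(0,0), (1,0), (1,1), (1,2), (0,2)]"] e by simp
  then show ?thesis by (simp only: V N_def)
qed

text \<open>Side length 1 in all further directions makes the box a copy of the rectangle;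
  \<open>p\<close> is the embedding. Both coordinates 0 and 1 exist because
  \<open>d \<ge> 2\<close>.\<close>

lemma box_count_2_3:
  assumes "d \<ge> 2"
  shows "box_count d (\<lambda>i. if i = 0 then 2 else if i = 1 then 3 else 1) \<le> 17"
proof -
  let ?s = "\<lambda>i. if i = 0 then 2 else if i = 1 then 3 else 1 :: nat"
  define p where "p = (\<lambda>(a, b). \<lambda>i\<in>{..<d}. if i = 0 then a else if i = 1 then b else (0 :: int))"
  have p01: "p (a, b) 0 = a" "p (a, b) 1 = b" for a b
    using assms by (auto simp: p_def)
  have inj: "inj_on p V" for V
    by (rule inj_onI) (metis p01 surj_pair)
  have step0: "p (a + 1, b) = (p (a, b))(0 := p (a, b) 0 + 1)" for a b
    using assms by (auto simp: p_def fun_eq_iff)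
  have step1: "p (a, b + 1) = (p (a, b))(1 := p (a, b) 1 + 1)" for a b
    using assms by (auto simp: p_def fun_eq_iff)
  have edge: "(p (a, b), p (a', b')) \<in> grid_edges d" if "\<bar>a - a'\<bar> + \<bar>b - b'\<bar> = 1" for a a' b b'
  proof -
    from that consider "a' = a + 1" "b' = b" | "a = a' + 1" "b' = b"
      | "a' = a" "b' = b + 1" | "a' = a" "b = b' + 1" by linarith
    then have "\<exists>i\<in>{0, 1}. p (a', b') = (p (a, b))(i := p (a, b) i + 1)
        \<or> p (a, b) = (p (a', b'))(i := p (a', b') i + 1)"
      by cases (simp_all only: step0 step1, blast+)
    then show ?thesis using assms unfolding grid_edges_def by fastforce
  qed
  let ?V = "{0..<2 :: int} \<times> {0..<3 :: int}"
  have "grid_box d ?s \<subseteq> p ` ?V"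
  proof
    fix x assume x: "x \<in> grid_box d ?s"
    have xi: "x i \<in> {0..<int (?s i)}" if "i < d" for i
      using x that unfolding grid_box_def by (blast dest: PiE_mem)
    have "x i = p (x 0, x 1) i" for i
    proof (cases "i < d")
      case True
      then show ?thesis using xi[of i] by (auto simp: p_def)
    next
      case False
      then show ?thesis using x by (auto simp: p_def grid_box_def PiE_iff extensional_def)
    qed
    then have "x = p (x 0, x 1)" by blast
    moreover have "(x 0, x 1) \<in> ?V"
      using xi[of 0] xi[of 1] assms by auto
    ultimately show "x \<in> p ` ?V" by blast
  qed
  then have "box_count d ?s \<le> card (indep_sets (grid_edges d) (p ` ?V))"
    unfolding box_count_def by (intro card_indep_sets_mono) auto
  also have "\<dots> \<le> card (indep_sets {((a, b), (a', b')). \<bar>a - a'\<bar> + \<bar>b - b'\<bar> = 1} ?V)"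
    by (rule card_indep_sets_image) (use inj edge in auto)
  also have "\<dots> \<le> 17" by (rule card_indep_sets_ladder)
  finally show ?thesis .
qed

section \<open>Comparison of the torus with the cube\<close>

abbreviation cube_count :: "nat \<Rightarrow> nat \<Rightarrow> nat" where
  "cube_count d n \<equiv> box_count d (\<lambda>_. n)"

lemma pverts_torus_graph: "n > 0 \<Longrightarrow> pverts (torus_graph d n) = grid_box d (\<lambda>_. n)"
  by (simp add: torus_graph_def cayley_graph_def torus_group_def carrier_integer_mod_group grid_box_def)

text \<open>For \<open>n \<ge> 2\<close> the residues of 1 and -1 are nonzero, so every signed unit
  vector survives as a generator. For \<open>n = 2\<close> the two signs give the same
  vector.\<close>

lemma torus_generators_eq:
  assumes "n \<ge> 2"
  shows "torus_generators d n =
    {\<lambda>j\<in>{..<d}. (if j = i then e else 0) mod int n | i e. i < d \<and> (e = 1 \<or> e = - 1)}"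
proof -
  let ?G = "torus_group d n"
  define g where "g i e = (\<lambda>j\<in>{..<d}. (if j = i then e else 0) mod int n)" for i e
  have unit: "torus_unit_vector d n i = g i 1" for i
    unfolding torus_unit_vector_def g_def by (rule restrict_ext) simp
  have inv_unit: "inv\<^bsub>?G\<^esub> torus_unit_vector d n i = g i (- 1)" for i
  proof -
    have in_carrier: "torus_unit_vector d n i \<in> (\<Pi>\<^sub>E j\<in>{..<d}. carrier (integer_mod_group n))"
      using assms torus_unit_vector_closed[of n d i] by (simp add: torus_group_def)
    have "inv\<^bsub>?G\<^esub> torus_unit_vector d n i
        = (\<lambda>j\<in>{..<d}. inv\<^bsub>integer_mod_group n\<^esub> torus_unit_vector d n i j)"
      unfolding torus_group_def by (rule inv_product_group[OF in_carrier]) simp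
    also have "\<dots> = g i (- 1)"
      unfolding g_def
    proof (rule restrict_ext)
      fix j assume "j \<in> {..<d}"
      moreover from this have "torus_unit_vector d n i j \<in> carrier (integer_mod_group n)"
        using in_carrier by (rule PiE_mem[rotated])
      ultimately show "inv\<^bsub>integer_mod_group n\<^esub> torus_unit_vector d n i j = (if j = i then - 1 else 0) mod int n"
        by (simp add: torus_unit_vector_def mod_minus_eq)
    qed
    finally show ?thesis .
  qed
  have ne: "g i e \<noteq> \<one>\<^bsub>?G\<^esub>" if "i < d" "e = 1 \<or> e = - 1" for i e
  proof
    assume "g i e = \<one>\<^bsub>?G\<^esub>"
    then have "g i e i = \<one>\<^bsub>?G\<^esub> i" by simp
    then have "int n dvd e" using that by (simp add: torus_group_def g_def mod_eq_0_iff_dvd)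
    then have "int n dvd 1" using that by auto
    then show False using assms by simp
  qed
  let ?U = "{g i e | i e. i < d \<and> (e = 1 \<or> e = - 1)}"
  have "torus_generators d n = (\<Union>i<d. {g i 1, g i (- 1)}) - {\<one>\<^bsub>?G\<^esub>}"
    unfolding torus_generators_def inv_unit unfolding unit by (rule refl)
  also have "(\<Union>i<d. {g i 1, g i (- 1)}) = ?U" by auto
  also have "\<one>\<^bsub>?G\<^esub> \<notin> ?U" using ne by force
  then have "?U - {\<one>\<^bsub>?G\<^esub>} = ?U" by (rule Diff_insert0[where B = "{}", simplified])
  finally show ?thesis unfolding g_def .
qed

text \<open>Coordinatewise congruences replace the group operations, so that wraparound becomes
  integer arithmetic.\<close>

lemma parcs_torus_graph:
  assumes "n \<ge> 2"
  shows "(x, y) \<in> parcs (torus_graph d n) \<longleftrightarrow>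
    x \<in> grid_box d (\<lambda>_. n) \<and> y \<in> grid_box d (\<lambda>_. n) \<and>
    (\<exists>i<d. \<exists>e. (e = 1 \<or> e = - 1) \<and>
      (\<forall>j<d. (y j - x j) mod int n = (if j = i then e else 0) mod int n))"
proof -
  let ?G = "torus_group d n"
  have carrier: "carrier ?G = grid_box d (\<lambda>_. n)"
    using assms by (simp add: torus_group_def carrier_integer_mod_group grid_box_def)
  have diff: "inv\<^bsub>?G\<^esub> x \<otimes>\<^bsub>?G\<^esub> y = (\<lambda>j\<in>{..<d}. (y j - x j) mod int n)"
    if "x \<in> carrier ?G" for x y
  proof -
    have "inv\<^bsub>?G\<^esub> x = (\<lambda>j\<in>{..<d}. (- x j) mod int n)"
      using that unfolding torus_group_def
      by (subst inv_product_group) (auto simp: fun_eq_iff PiE_iff)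
    then show ?thesis by (auto simp: torus_group_def mod_add_left_eq fun_eq_iff)
  qed
  have ext: "(\<lambda>j\<in>{..<d}. f j) = (\<lambda>j\<in>{..<d}. g j) \<longleftrightarrow> (\<forall>j<d. f j = g j)" for f g :: "nat \<Rightarrow> int"
    by (auto simp: fun_eq_iff restrict_def)
  have "(x, y) \<in> parcs (torus_graph d n) \<longleftrightarrow>
      x \<in> carrier ?G \<and> y \<in> carrier ?G \<and> inv\<^bsub>?G\<^esub> x \<otimes>\<^bsub>?G\<^esub> y \<in> torus_generators d n"
    by (simp add: torus_graph_def cayley_graph_def)
  also have "\<dots> \<longleftrightarrow> x \<in> carrier ?G \<and> y \<in> carrier ?G
      \<and> (\<lambda>j\<in>{..<d}. (y j - x j) mod int n) \<in> torus_generators d n"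
    using diff by metis
  finally show ?thesis
    unfolding torus_generators_eq[OF assms] carrier mem_Collect_eq ext by blast
qed

lemma num_indep_eq: "n > 0 \<Longrightarrow> num_indep d n
    = card (indep_sets (parcs (torus_graph d n)) (grid_box d (\<lambda>_. n)))"
  by (simp add: num_indep_def indep_sets_def independent_vertex_set_def pverts_torus_graph)

text \<open>On the same vertices the torus has all edges of the cube and possibly wraparound edges
  besides, hence no more independent sets.\<close>

lemma num_indep_le_cube_count:
  assumes "n \<ge> 2"
  shows "num_indep d n \<le> cube_count d n"
proof -
  let ?B = "grid_box d (\<lambda>_. n)"
  have step: "(x, y) \<in> parcs (torus_graph d n) \<and> (y, x) \<in> parcs (torus_graph d n)"
    if "x \<in> ?B" "y \<in> ?B" "i < d" "y = x(i := x i + 1)" for x y i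
  proof -
    have "\<forall>j<d. (y j - x j) mod int n = (if j = i then 1 else 0) mod int n"
      "\<forall>j<d. (x j - y j) mod int n = (if j = i then - 1 else 0) mod int n"
      using that by simp_all
    then show ?thesis unfolding parcs_torus_graph[OF assms] using that(1-3) by blast
  qed
  have arc: "(x, y) \<in> parcs (torus_graph d n)" if "x \<in> ?B" "y \<in> ?B" "(x, y) \<in> grid_edges d" for x y
    using that step unfolding grid_edges_def by blast
  have "num_indep d n = card (indep_sets (parcs (torus_graph d n)) ((\<lambda>x. x) ` ?B))"
    using assms by (simp add: num_indep_eq)
  also have "\<dots> \<le> cube_count d n"
    unfolding box_count_def using arc by (intro card_indep_sets_image) auto
  finally show ?thesis .
qed

text \<open>In the torus of side \<open>n + 1\<close> the cube of side \<open>n\<close> misses one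
  layer in each direction, so no wraparound edge joins two of its vertices.\<close>

lemma cube_count_le_num_indep:
  assumes "n \<ge> 1"
  shows "cube_count d n \<le> num_indep d (Suc n)"
proof -
  let ?B = "grid_box d (\<lambda>_. n)" and ?E = "parcs (torus_graph d (Suc n))"
  have edge: "(x, y) \<in> grid_edges d" if x: "x \<in> ?B" and y: "y \<in> ?B" and "(x, y) \<in> ?E" for x y
  proof -
    from that(3) obtain i e where i: "i < d" and e: "e = 1 \<or> e = - 1"
      and mod_eq: "\<And>j. j < d \<Longrightarrow> (y j - x j) mod int (Suc n) = (if j = i then e else 0) mod int (Suc n)"
      using assms by (subst (asm) parcs_torus_graph) auto
    have diff: "y j - x j = (if j = i then e else 0)" if "j < d" for j
    proof -
      have "x j \<in> {0..<int n}" "y j \<in> {0..<int n}"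
        using x y that by (auto simp: grid_box_def PiE_iff)
      \<comment> \<open>Coordinates differ by at most \<open>n - 1\<close> and \<open>e\<close> adds
        at most 1, so the only possible multiple of \<open>n + 1\<close> is 0.\<close>
      then have less: "\<bar>y j - x j - (if j = i then e else 0)\<bar> < int (Suc n)" (is "\<bar>?z\<bar> < _")
        using e by auto
      have dvd: "int (Suc n) dvd ?z"
        using mod_eq[OF that] by (simp only: mod_eq_dvd_iff)
      have "?z = 0"
      proof (rule ccontr)
        assume "?z \<noteq> 0"
        from dvd_imp_le_int[OF this dvd] less show False by linarith
      qed
      then show ?thesis by linarith
    qed
    have out: "x j = undefined" "y j = undefined" if "\<not> j < d" for j
      using x y that by (auto simp: grid_box_def PiE_iff extensional_def)
    have "y j = (x(i := x i + e)) j" for j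
      using diff[of j] out[of j] i by (cases "j < d") auto
    then have "y = x(i := x i + e)" by blast
    with e i have "y = x(i := x i + 1) \<or> x = y(i := y i + 1)" by auto
    with i show ?thesis by (auto simp: grid_edges_def)
  qed
  have "cube_count d n = card (indep_sets (grid_edges d) ((\<lambda>x. x) ` ?B))"
    by (simp add: box_count_def)
  also have "\<dots> \<le> card (indep_sets ?E ?B)"
    using edge by (intro card_indep_sets_image) auto
  also have "?B \<subseteq> grid_box d (\<lambda>_. Suc n)"
    unfolding grid_box_def by (intro PiE_mono) auto
  then have "card (indep_sets ?E ?B) \<le> num_indep d (Suc n)"
    unfolding num_indep_eq[OF zero_less_Suc] by (rule card_indep_sets_mono[OF finite_grid_box])
  finally show ?thesis .
qed

lemma num_indep_ge_2:
  assumes "n \<ge> 1"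
  shows "num_indep d n \<ge> 2"
proof -
  let ?I = "indep_sets (parcs (torus_graph d n)) (grid_box d (\<lambda>_. n))"
  interpret pair_graph "torus_graph d n" by (rule pair_graph_torus_graph[OF assms])
  define v where "v = (\<lambda>i\<in>{..<d}. 0 :: int)"
  have "v \<in> grid_box d (\<lambda>_. n)" using assms by (auto simp: grid_box_def v_def)
  moreover have "(v, v) \<notin> parcs (torus_graph d n)" using no_loops' by blast
  ultimately have "{{}, {v}} \<subseteq> ?I" by (auto simp: indep_sets_def)
  then have "card {{}, {v}} \<le> card ?I" by (intro card_mono finite_indep_sets finite_grid_box)
  then show ?thesis using assms by (simp add: num_indep_eq)
qed

section \<open>The entropy limit\<close>

definition entropy_density :: "nat \<Rightarrow> nat \<Rightarrow> real" where
  "entropy_density d n = ln (cube_count d n) / n ^ d"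

lemma ln_cube_count_nonneg: "ln (real (cube_count d n)) \<ge> 0"
  using box_count_pos[of d "\<lambda>_. n"] by simp

lemma entropy_density_nonneg: "entropy_density d n \<ge> 0"
  by (simp add: entropy_density_def ln_cube_count_nonneg)

text \<open>The cube of side \<open>n\<close> lies in a cube tiled by \<open>m ^ d\<close> cubes of
  side \<open>k\<close>. The term \<open>1 / n\<close> accounts for the overhang and vanishes as
  \<open>n\<close> grows.\<close>

lemma entropy_density_le:
  assumes "k \<ge> 1" "n \<ge> 1"
  shows "entropy_density d n \<le> (1 / k + 1 / n) ^ d * ln (cube_count d k)"
proof -
  define m where "m = n div k + 1"
  have "n \<le> m * k"
    using assms(1) dividend_less_div_times[of k n] by (simp add: m_def)
  then have "cube_count d n \<le> box_count d (\<lambda>_. m * k)" by (intro box_count_mono) auto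
  also have "\<dots> \<le> cube_count d k ^ (m ^ d)"
    using box_count_tiling[of d "\<lambda>_. k" "\<lambda>_. m"] assms(1) by simp
  finally have "real (cube_count d n) \<le> real (cube_count d k) ^ (m ^ d)"
    by (metis of_nat_le_iff of_nat_power)
  then have "ln (real (cube_count d n)) \<le> ln (real (cube_count d k) ^ (m ^ d))"
    using box_count_pos by (subst ln_le_cancel_iff) auto
  also have "\<dots> = real m ^ d * ln (cube_count d k)"
    using box_count_pos by (subst ln_realpow) auto
  finally have "entropy_density d n \<le> (m / n) ^ d * ln (cube_count d k)"
    by (simp add: entropy_density_def power_divide divide_right_mono)
  also have "m / n \<le> 1 / k + 1 / n"
    using assms of_nat_div_le_of_nat[of n k, where 'a = real] by (simp add: m_def field_simps)
  then have "(m / n) ^ d * ln (cube_count d k) \<le> (1 / k + 1 / n) ^ d * ln (cube_count d k)"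
    by (intro mult_right_mono power_mono ln_cube_count_nonneg) auto
  finally show ?thesis .
qed

text \<open>As an infimum, the value is bounded above by the density of any single cube, which later
  yields the numerical estimate. Side 0 is left out: for \<open>d \<ge> 1\<close> its density is a
  division by zero, which evaluates to 0.\<close>

definition entropy :: "nat \<Rightarrow> real" where
  "entropy d = (INF k\<in>{1..}. entropy_density d k)"

lemma bdd_below_entropy_density: "bdd_below (entropy_density d ` A)"
  by (rule bdd_belowI2[of _ 0]) (rule entropy_density_nonneg)

lemma entropy_le: "k \<ge> 1 \<Longrightarrow> entropy d \<le> entropy_density d k"
  unfolding entropy_def by (rule cINF_lower[OF bdd_below_entropy_density]) auto

lemma entropy_nonneg: "entropy d \<ge> 0"
  unfolding entropy_def by (rule cINF_greatest) (auto intro: entropy_density_nonneg)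

text \<open>Fekete's argument: no density lies below the infimum, and a fixed \<open>k\<close> of
  nearly minimal density bounds all large \<open>n\<close> through the tiling estimate.\<close>

lemma entropy_density_tendsto: "entropy_density d \<longlonglongrightarrow> entropy d"
proof (rule order_tendstoI)
  fix a assume "a < entropy d"
  then have "a < entropy_density d n" if "n \<ge> 1" for n
    using entropy_le[OF that, of d] by linarith
  then show "\<forall>\<^sub>F n in sequentially. a < entropy_density d n"
    using eventually_ge_at_top[of 1] by (rule eventually_mono[rotated])
next
  fix a assume "entropy d < a"
  then obtain k where k: "k \<ge> 1" "entropy_density d k < a"
    unfolding entropy_def
    by (subst (asm) cINF_less_iff) (auto intro: bdd_below_entropy_density)
  have "(\<lambda>n. (1 / k + 1 / real n) ^ d * ln (cube_count d k)) \<longlonglongrightarrow> (1 / k + 0) ^ d * ln (cube_count d k)"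
    by (intro tendsto_intros lim_1_over_n)
  moreover have "(1 / k + 0) ^ d * ln (cube_count d k) = entropy_density d k"
    by (simp add: entropy_density_def power_divide)
  ultimately have "\<forall>\<^sub>F n in sequentially. (1 / k + 1 / real n) ^ d * ln (cube_count d k) < a"
    using k(2) by (metis order_tendstoD(2))
  then show "\<forall>\<^sub>F n in sequentially. entropy_density d n < a"
    using eventually_ge_at_top[of 1]
  proof eventually_elim
    case (elim n)
    then show ?case using entropy_density_le[OF k(1), of n d] by linarith
  qed
qed

text \<open>A squeeze for the torus of side \<open>n + 1\<close>: from above by the cube of the same
  side, from below by the cube of side \<open>n\<close>, rescaled by a volume ratio that tends to
  1.\<close>

lemma ln_num_indep_tendsto: "(\<lambda>n. ln (num_indep d n) / real n ^ d) \<longlonglongrightarrow> entropy d"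
proof (rule LIMSEQ_imp_Suc, rule tendsto_sandwich)
  show "(\<lambda>n. entropy_density d n * (real n / real (Suc n)) ^ d) \<longlonglongrightarrow> entropy d"
    using tendsto_mult[OF entropy_density_tendsto[of d] tendsto_power[OF LIMSEQ_n_over_Suc_n, of d]]
    by simp
  show "(\<lambda>n. entropy_density d (Suc n)) \<longlonglongrightarrow> entropy d"
    by (rule LIMSEQ_Suc[OF entropy_density_tendsto])
  show "\<forall>\<^sub>F n in sequentially. entropy_density d n * (real n / real (Suc n)) ^ d
      \<le> ln (num_indep d (Suc n)) / real (Suc n) ^ d"
    using eventually_ge_at_top[of 1]
  proof eventually_elim
    case (elim n)
    have "entropy_density d n * (real n / real (Suc n)) ^ d = ln (cube_count d n) / real (Suc n) ^ d"
      using elim by (simp add: entropy_density_def power_divide)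
    also have "\<dots> \<le> ln (num_indep d (Suc n)) / real (Suc n) ^ d"
      using cube_count_le_num_indep[OF elim, of d] box_count_pos[of d "\<lambda>_. n"]
      by (intro divide_right_mono) auto
    finally show ?case .
  qed
  show "\<forall>\<^sub>F n in sequentially. ln (num_indep d (Suc n)) / real (Suc n) ^ d \<le> entropy_density d (Suc n)"
    using eventually_ge_at_top[of 1]
  proof eventually_elim
    case (elim n)
    have "num_indep d (Suc n) > 0" using num_indep_ge_2[of "Suc n" d] by simp
    then show ?case
      unfolding entropy_density_def of_nat_power using num_indep_le_cube_count[of "Suc n" d] elim
      by (intro divide_right_mono) auto
  qed
qed

text \<open>Since \<open>lim\<close> is meaningful only for convergent sequences, convergence of the
  roots is proved first, by exponentiating the logarithmic limit.\<close>

lemma kappa_eq_exp_entropy: "kappa d = exp (entropy d)"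
proof -
  have "(\<lambda>n. exp (ln (num_indep d n) / real n ^ d)) \<longlonglongrightarrow> exp (entropy d)"
    by (intro tendsto_exp ln_num_indep_tendsto)
  then have "(\<lambda>n. root (n ^ d) (real (num_indep d n))) \<longlonglongrightarrow> exp (entropy d)"
  proof (rule Lim_transform_eventually)
    show "\<forall>\<^sub>F n in sequentially. exp (ln (num_indep d n) / real n ^ d) = root (n ^ d) (real (num_indep d n))"
      using eventually_ge_at_top[of 1]
    proof eventually_elim
      case (elim n)
      then show ?case
        using num_indep_ge_2[OF elim, of d] by (simp add: root_powr_inverse powr_def)
    qed
  qed
  then show ?thesis unfolding kappa_def by (rule limI)
qed

lemma kappa_ge_1: "kappa d \<ge> 1"
  by (simp add: kappa_eq_exp_entropy entropy_nonneg)

lemma kappa_pow_6_le: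
  assumes "d \<ge> 2"
  shows "kappa d ^ 6 \<le> 17"
proof -
  let ?s = "\<lambda>i. if i = 0 then 2 else if i = 1 then 3 else 1 :: nat"
  \<comment> \<open>Numbers of tiles along each direction of the cube of side 6:
    \<open>6 / 2\<close>, \<open>6 / 3\<close> and \<open>6 / 1\<close>.\<close>
  let ?m = "\<lambda>i. if i = 0 then 3 else if i = 1 then 2 else 6 :: nat"
  define M where "M = (\<Prod>i<d. ?m i)"
  obtain e where e: "d = Suc (Suc e)" using assms by (metis Suc_le_D numeral_2_eq_2 Suc_le_mono)
  \<comment> \<open>Each tile has 6 vertices, so \<open>M\<close> tiles fill the cube exactly; this
    is the source of the sixth power.\<close>
  have M: "6 * M = 6 ^ d" by (simp add: M_def e prod.lessThan_Suc_shift del: prod.lessThan_Suc)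
  have "cube_count d 6 \<le> box_count d (\<lambda>i. ?m i * ?s i)"
    by (intro box_count_mono) auto
  also have "\<dots> \<le> box_count d ?s ^ M"
    unfolding M_def by (rule box_count_tiling) auto
  also have "\<dots> \<le> 17 ^ M"
    using box_count_2_3[OF assms] by (rule power_mono) auto
  finally have "real (cube_count d 6) \<le> 17 ^ M"
    by (metis of_nat_le_iff of_nat_power of_nat_numeral)
  then have "ln (real (cube_count d 6)) \<le> ln (17 ^ M)"
    using box_count_pos by (subst ln_le_cancel_iff) auto
  also have "\<dots> = M * ln 17" by (simp add: ln_realpow)
  finally have "6 * entropy_density d 6 \<le> 6 * (M * ln 17 / 6 ^ d)"
    by (simp add: entropy_density_def divide_right_mono)
  also have "\<dots> = real (6 * M) / 6 ^ d * ln 17" by simp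
  also have "\<dots> = ln 17" unfolding M by simp
  finally have "6 * entropy d \<le> ln 17" using entropy_le[of 6 d] by simp
  then have "exp (6 * entropy d) \<le> 17" by (simp add: ln_ge_iff)
  then show ?thesis by (simp add: kappa_eq_exp_entropy flip: exp_of_nat_mult)
qed

section \<open>Exactness and quadratic units\<close>

text \<open>The conclusion expresses that \<open>x\<close> is at least the golden ratio without a
  square root. For \<open>q = 1\<close>, a root above 1 forces \<open>p \<le> -3\<close>, so the
  square is at least \<open>3 * x - 1\<close>; for \<open>q = - 1\<close> it forces
  \<open>p \<le> -1\<close>, so the square is at least \<open>x + 1\<close>.\<close>

lemma quadratic_unit_ge_golden_ratio:
  fixes x p q :: real
  assumes "p \<in> \<int>" "q = 1 \<or> q = - 1" "x ^ 2 + p * x + q = 0" "x > 1"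
  shows "x ^ 2 \<ge> x + 1"
proof (rule ccontr)
  assume "\<not> x ^ 2 \<ge> x + 1"
  then have small: "x ^ 2 < x + 1" by simp
  obtain a where a: "p = of_int a" using assms(1) by (auto elim: Ints_cases)
  have x: "x * x + p * x + q = 0" using assms(3) by (simp add: power2_eq_square)
  from assms(2) show False
  proof
    assume q: "q = 1"
    have "a \<le> - 3"
    proof (rule ccontr)
      assume "\<not> a \<le> - 3"
      then have "- 2 \<le> p" using a by simp
      then have "- 2 * x \<le> p * x" using assms(4) by (intro mult_right_mono) auto
      moreover have "(x - 1) * (x - 1) > 0" using assms(4) by simp
      ultimately show False using x q by (simp add: algebra_simps)
    qed
    then have "p * x \<le> - 3 * x" using a assms(4) by (intro mult_right_mono) auto
    then have "x * x + 1 \<ge> 3 * x" using x q by linarith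
    then show False using small assms(4) by (simp add: power2_eq_square)
  next
    assume q: "q = - 1"
    have "a \<le> - 1"
    proof (rule ccontr)
      assume "\<not> a \<le> - 1"
      then have "p * x \<ge> 0" using a assms(4) by simp
      moreover have "x * x > 1" using assms(4) by (simp add: less_1_mult)
      ultimately show False using x q by linarith
    qed
    then have "p * x \<le> - 1 * x" using a assms(4) by (intro mult_right_mono) auto
    then show False using x q small by (simp add: power2_eq_square)
  qed
qed

lemma exact_set_empty:
  assumes "algebraic_int y" "kappa d * y = 1"
  shows "exact_set d = {}"
proof (rule equals0I)
  fix n assume "n \<in> exact_set d"
  then have n: "n \<ge> 1" "real (num_indep d n) = kappa d ^ (n ^ d)"
    by (auto simp: exact_set_def)
  let ?z = "y ^ (n ^ d)"
  \<comment> \<open>The power of \<open>y\<close> inverts a natural number, so it is rational as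
    well as an algebraic integer.\<close>
  have az: "real (num_indep d n) * ?z = 1"
    using assms(2) by (simp add: n(2) flip: power_mult_distrib)
  then have "?z = 1 / real (num_indep d n)"
    using num_indep_ge_2[OF n(1), of d] by (simp add: field_simps)
  then have "?z \<in> \<rat>" by simp
  then have "?z \<in> \<int>" using assms(1) algebraic_int_power rational_algebraic_int_is_int by blast
  then obtain b where b: "?z = of_int b" by (auto elim: Ints_cases)
  have "of_int (int (num_indep d n) * b) = (1 :: real)" using az by (simp add: b)
  then have "int (num_indep d n) * b = 1" by (simp only: of_int_eq_1_iff)
  then show False using num_indep_ge_2[OF n(1), of d] by (auto simp: zmult_eq_1_iff)
qed

theorem proposition5p17:
  fixes d :: nat and K :: "real set" and D :: nat
  assumes "d \<ge> 1"
    and "K = rat_adjoin (kappa d)"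
    and "algebraic_int (kappa d)"
    and "kappa d \<in> Units (ring_of_integers K)"
    and "D = degree_over_rat K"
  shows "exact_set d = {} \<and> (D = 2 \<longrightarrow> d = 1)"
proof -
  let ?x = "kappa d"
  \<comment> \<open>Being a unit is used only through this inverse, which is again an algebraic
    integer.\<close>
  from assms(4) obtain y where y: "algebraic_int y" "?x * y = 1"
    by (auto simp: Units_def ring_of_integers_def ring_of_type_algebra_def)
  have "d = 1" if "D = 2"
  proof (rule ccontr)
    assume "d \<noteq> 1"
    with assms(1) have d: "d \<ge> 2" by simp
    have deg: "degree_over_rat (rat_adjoin ?x) = 2" using that assms(2,5) by simp
    obtain p q where pq: "?x \<notin> \<rat>" "p \<in> \<rat>" "q \<in> \<rat>" "?x ^ 2 + p * ?x + q = 0"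
      using degree_over_rat_2E[OF assms(3) deg] by blast
    have "?x \<noteq> 1" using pq(1) by auto
    then have "?x > 1" using kappa_ge_1[of d] by simp
    then have gr: "?x ^ 2 \<ge> ?x + 1"
      using quadratic_unit_ge_golden_ratio quadratic_unit_coeffs[OF assms(3) y pq] pq(4) by blast
    \<comment> \<open>A rational stand-in for the golden ratio: \<open>1.61 * 0.61\<close> is below
      1, while the sixth power of 1.61 is about 17.4 and so still exceeds 17.\<close>
    have "?x > 1.61"
    proof (rule ccontr)
      assume "\<not> ?x > 1.61"
      then have "?x * (?x - 1) \<le> 1.61 * (1.61 - 1)"
        using \<open>?x > 1\<close> by (intro mult_mono) auto
      then show False using gr by (simp add: power2_eq_square algebra_simps)
    qed
    then have "1.61 ^ 6 < ?x ^ 6" by (intro power_strict_mono) auto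
    moreover have "(1.61 :: real) ^ 6 > 17" by (simp add: power_numeral_reduce)
    ultimately show False using kappa_pow_6_le[OF d] by linarith
  qed
  then show ?thesis using exact_set_empty[OF y] by blast
qed

end
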